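(* Let $k \geq 2$, let $\underline{r} = (r_1,\ldots,r_k) \in \mathbb{R}^k$, and let $(Z_n : NC^{\mathrm{(mton)}}(n) \to \mathbb{R})_{n\geq 1}$ be a sequence which is recursive of the first kind with input $\underline{r}$. For $n \in \mathbb{N}$ let $L_n(t) = \sum_{(\pi,u) \in NC^{\mathrm{(mton)}}(n)} t^{Z_n(\pi,u)}$, $t>0$. Then for every $n > k$ and $t \in (0,\infty)$, $$L_n(t) = (1 + n t^{r_1}) L_{n-1}(t) + \sum_{j=2}^k (n-j+1)\,(t^{r_j} - 1)\, t^{r_1 + \cdots + r_{j-1}}\, L_{n-j}(t).$$
   Context: $NC(n)$: non-crossing partitions of $\{1,\ldots,n\}$. For blocks $V,W$, "$V$ nested inside $W$" means $\min V>\min W$ and $\max V<\max W$. A monotonic ordering of $\pi\in NC(n)$ is a bijection $u:\pi\to\{1,\ldots,|\pi|\}$ with $u(V)>u(W)$ whenever $V$ is nested inside $W$; $NC^{\mathrm{(mton)}}(n)$ is the set of pairs $(\pi,u)$ with $u$ a monotonic ordering of $\pi\in NC(n)$. For $(\pi,u)\in NC^{\mathrm{(mton)}}(n)$, $J(\pi,u) := u^{-1}(|\pi|)$ (it is an interval of $\{1,\ldots,n\}$). For $n\ge 2$, the parent $\mathfrak{p}(\pi,u)=(\rho,v)\in NC^{\mathrm{(mton)}}(n-1)$ is defined as follows: let $m=\max J(\pi,u)$ and let $\phi$ be the increasing bijection from $\{1,\ldots,n\}\setminus\{m\}$ onto $\{1,\ldots,n-1\}$; then $\rho=\{\phi(V\setminus\{m\})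 : V\in\pi,\ V\neq\{m\}\}$ and $v(\phi(V\setminus\{m\})) := u(V)$ for $V\in\pi$, $V\ne\{m\}$. A sequence $(Z_n)$ is recursive of the first kind with input $\underline{r}=(r_1,\ldots,r_k)$ if for every $n\ge 2$ and $(\pi,u)\in NC^{\mathrm{(mton)}}(n)$ with $\mathfrak{p}(\pi,u)=(\rho,v)$: $Z_n(\pi,u)=Z_{n-1}(\rho,v)+r_j$ if $|J(\pi,u)|=j\le k$, and $Z_n(\pi,u)=Z_{n-1}(\rho,v)$ if $|J(\pi,u)|>k$. *)

theory Defs
  imports Complex_Main "HOL-Library.Disjoint_Sets" "HOL-Library.FuncSet"
begin

definition noncrossing :: "nat set set \<Rightarrow> bool" where
  "noncrossing \<pi> \<longleftrightarrow>
     \<not> (\<exists>V\<in>\<pi>. \<exists>W\<in>\<pi>. V \<noteq> W \<and>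
          (\<exists>a b c d. a < b \<and> b < c \<and> c < d \<and> a \<in> V \<and> c \<in> V \<and> b \<in> W \<and> d \<in> W))"

definition NC :: "nat \<Rightarrow> nat set set set" where
  "NC n = {\<pi>. partition_on {1..n} \<pi> \<and> noncrossing \<pi>}"

definition nested_inside :: "nat set \<Rightarrow> nat set \<Rightarrow> bool" where
  "nested_inside V W \<longleftrightarrow> Min V > Min W \<and> Max V < Max W"

type_synonym ordered_partition = "nat set set \<times> (nat set \<Rightarrow> nat)"

text \<open>An ordering is a function on the blocks of \<open>\<pi>\<close> only. Functions being total here, it is
  required to be extensional, so that distinct pairs in \<open>NC_mton n\<close> are distinct
  mathematical objects and sums over this set count each of them once.\<close>

definition monotonic_ordering :: "nat set set \<Rightarrow> (nat set \<Rightarrow> nat) \<Rightarrow> bool" where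
  "monotonic_ordering \<pi> u \<longleftrightarrow>
     u \<in> extensional \<pi> \<and> bij_betw u \<pi> {1..card \<pi>} \<and>
     (\<forall>V\<in>\<pi>. \<forall>W\<in>\<pi>. nested_inside V W \<longrightarrow> u V > u W)"

definition NC_mton :: "nat \<Rightarrow> ordered_partition set" where
  "NC_mton n = {(\<pi>, u). \<pi> \<in> NC n \<and> monotonic_ordering \<pi> u}"

definition J :: "ordered_partition \<Rightarrow> nat set" where
  "J = (\<lambda>(\<pi>, u). inv_into \<pi> u (card \<pi>))"

definition relabel :: "nat \<Rightarrow> nat \<Rightarrow> nat" where
  "relabel m i = (if i < m then i else i - 1)"

lemma relabel_increasing_bijection:
  assumes "m \<in> {1..n}"
  shows "bij_betw (relabel m) ({1..n} - {m}) {1..n - 1}"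
    and "strict_mono_on ({1..n} - {m}) (relabel m)"
proof -
  show mono: "strict_mono_on ({1..n} - {m}) (relabel m)"
    by (auto simp: strict_mono_on_def relabel_def)
  have "x \<in> relabel m ` ({1..n} - {m})" if "x \<in> {1..n - 1}" for x
  proof (cases "x < m")
    case True
    with that show ?thesis
      by (intro image_eqI[of _ _ x]) (auto simp: relabel_def)
  next
    case False
    with that show ?thesis
      by (intro image_eqI[of _ _ "Suc x"]) (auto simp: relabel_def)
  qed
  moreover have "relabel m ` ({1..n} - {m}) \<subseteq> {1..n - 1}"
    using assms by (auto simp: relabel_def)
  ultimately show "bij_betw (relabel m) ({1..n} - {m}) {1..n - 1}"
    using strict_mono_on_imp_inj_on[OF mono] by (auto simp: bij_betw_def)
qed

text \<open>The definite description recovers the block \<open>V\<close> with \<open>\<phi>(V - {m}) = B\<close>, where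
  \<open>\<phi> = relabel m\<close>; it is unique since distinct blocks \<open>V \<noteq> {m}\<close> have disjoint
  nonempty images.\<close>

definition parent :: "ordered_partition \<Rightarrow> ordered_partition" where
  "parent = (\<lambda>(\<pi>, u).
     let m = Max (J (\<pi>, u));
         \<rho> = {relabel m ` (V - {m}) | V. V \<in> \<pi> \<and> V \<noteq> {m}}
     in (\<rho>, \<lambda>B\<in>\<rho>. u (THE V. V \<in> \<pi> \<and> V \<noteq> {m} \<and> B = relabel m ` (V - {m}))))"

text \<open>The input \<open>(r\<^sub>1, \<dots>, r\<^sub>k)\<close> is a function of which only the values at
  \<open>1, \<dots>, k\<close> are used; likewise \<open>Z n\<close> is used only on \<open>NC_mton n\<close> with \<open>n \<ge> 1\<close>.\<close>

definition recursive_first_kind ::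
  "nat \<Rightarrow> (nat \<Rightarrow> real) \<Rightarrow> (nat \<Rightarrow> ordered_partition \<Rightarrow> real) \<Rightarrow> bool" where
  "recursive_first_kind k r Z \<longleftrightarrow>
     (\<forall>n\<ge>2. \<forall>p\<in>NC_mton n.
        (card (J p) \<le> k \<longrightarrow> Z n p = Z (n - 1) (parent p) + r (card (J p))) \<and>
        (card (J p) > k \<longrightarrow> Z n p = Z (n - 1) (parent p)))"

definition L :: "(nat \<Rightarrow> ordered_partition \<Rightarrow> real) \<Rightarrow> nat \<Rightarrow> real \<Rightarrow> real" where
  "L Z n t = (\<Sum>p\<in>NC_mton n. t powr Z n p)"

lemma finite_NC_mton: "finite (NC_mton n)"
proof -
  have "NC_mton n \<subseteq> Sigma (Pow (Pow {1..n})) (\<lambda>\<pi>. PiE \<pi> (\<lambda>_. {1..card \<pi>}))"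
    by (auto simp: NC_mton_def NC_def monotonic_ordering_def bij_betw_def PiE_iff
        extensional_def dest: partition_onD1)
  moreover have "finite (Sigma (Pow (Pow {1..n})) (\<lambda>\<pi>. PiE \<pi> (\<lambda>_. {1..card \<pi>})))"
    by (intro finite_SigmaI finite_PiE) (auto intro: finite_subset[OF _ finite_Pow_iff[THEN iffD2]])
  ultimately show ?thesis
    by (rule finite_subset)
qed

end

theory Submission
  imports Defs
begin

text \<open>Reading off the label of the block of each point turns \<open>NC_mton n\<close> into a set of words of
  length \<open>n\<close>, in which taking the parent deletes the last occurrence of the largest letter. A word
  of length \<open>n - 1\<close> therefore has \<open>n + 1\<close> children: a new largest letter may be inserted at any
  of \<open>n\<close> places, or the run of the largest letter may be lengthened by one. Let \<open>A n j\<close> be the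
  part of \<open>L Z n t\<close> in which \<open>J\<close> has \<open>j\<close> elements. Then \<open>A n 1 = n * t powr r 1 * L Z (n - 1) t\<close>
  and \<open>A n (j + 1) = t powr r (j + 1) * A (n - 1) j\<close>, with factor \<open>1\<close> instead if \<open>j + 1 > k\<close>.
  Hence \<open>L Z n t - (1 + n * t powr r 1) * L Z (n - 1) t\<close> is the sum of
  \<open>(t powr r j - 1) * A (n - 1) (j - 1)\<close> over \<open>2 \<le> j \<le> k\<close>, and iterating the recursion for
  \<open>A\<close> expresses these terms by \<open>L Z (n - j) t\<close>.\<close>

section \<open>Ordered partitions as words\<close>

text \<open>Letters are positive and words are padded by zeros, so that no range restrictions are needed
  in the last condition, which expresses noncrossing and monotonic at once.\<close>

definition words :: "nat \<Rightarrow> (nat \<Rightarrow> nat) set" where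
  "words n = {w. (\<forall>i. 0 < w i \<longleftrightarrow> i \<in> {1..n}) \<and> (\<exists>M. range w = {..M}) \<and>
     (\<forall>a b c. a \<le> b \<longrightarrow> b \<le> c \<longrightarrow> w a = w c \<longrightarrow> w a \<le> w b)}"

definition top_letter :: "(nat \<Rightarrow> nat) \<Rightarrow> nat" where
  "top_letter w = Max (range w)"

text \<open>Letter 0 is left out because it is padding and not the label of a block.\<close>

definition levels :: "(nat \<Rightarrow> nat) \<Rightarrow> nat set set" where
  "levels w = (\<lambda>x. w -` {x}) ` {1..top_letter w}"

text \<open>A word is constant on each of its levels, so \<open>Min B\<close> merely picks a
  representative. The restriction makes the labelling extensional.\<close>

definition of_word :: "(nat \<Rightarrow> nat) \<Rightarrow> ordered_partition" where
  "of_word w = (levels w, \<lambda>B\<in>levels w. w (Min B))"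

text \<open>This becomes the block \<open>J\<close>. For \<open>w \<in> words n\<close> it is an
  interval when \<open>1 \<le> n\<close>, because no smaller letter may stand between two
  occurrences of the largest one.\<close>

definition top_run :: "(nat \<Rightarrow> nat) \<Rightarrow> nat set" where
  "top_run w = w -` {top_letter w}"

lemma top_letter_eq: "range w = {..M} \<Longrightarrow> top_letter w = M"
  by (simp add: top_letter_def Max_eq_iff)

lemma wordsI:
  assumes "\<And>i. 0 < w i \<longleftrightarrow> i \<in> {1..n}" "range w = {..M}"
    and "\<And>a b c. a \<le> b \<Longrightarrow> b \<le> c \<Longrightarrow> w a = w c \<Longrightarrow> w a \<le> w b"
  shows "w \<in> words n"
  using assms unfolding words_def by blast

lemma words_pos_iff: "w \<in> words n \<Longrightarrow> 0 < w i \<longleftrightarrow> i \<in> {1..n}"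
  by (simp add: words_def)

lemma words_between: "w \<in> words n \<Longrightarrow> a \<le> b \<Longrightarrow> b \<le> c \<Longrightarrow> w a = w c \<Longrightarrow> w a \<le> w b"
  by (simp add: words_def)

lemma words_range: "w \<in> words n \<Longrightarrow> range w = {..top_letter w}"
  using top_letter_eq by (auto simp: words_def)

lemma words_le_top: "w \<in> words n \<Longrightarrow> w i \<le> top_letter w"
  using words_range[of w n] by (metis atMost_iff rangeI)

lemma words_top_pos: "w \<in> words n \<Longrightarrow> 1 \<le> n \<Longrightarrow> 0 < top_letter w"
  using words_le_top[of w n 1] words_pos_iff[of w n 1] by simp

lemma level_subset: "w \<in> words n \<Longrightarrow> 0 < x \<Longrightarrow> w -` {x} \<subseteq> {1..n}"
  using words_pos_iff by blast

lemma finite_level: "w \<in> words n \<Longrightarrow> 0 < x \<Longrightarrow> finite (w -` {x})"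
  by (rule finite_subset[OF level_subset]) simp_all

lemma level_nonempty:
  assumes "w \<in> words n" "x \<le> top_letter w"
  shows "w -` {x} \<noteq> {}"
proof -
  have "x \<in> range w"
    unfolding words_range[OF assms(1)] using assms(2) by simp
  then show ?thesis by blast
qed

lemma word_Min_level:
  assumes "w \<in> words n" "x \<in> {1..top_letter w}"
  shows "w (Min (w -` {x})) = x"
  using Min_in[OF finite_level[OF assms(1)] level_nonempty[OF assms(1)], of x] assms(2) by simp

lemma word_Max_level:
  assumes "w \<in> words n" "x \<in> {1..top_letter w}"
  shows "w (Max (w -` {x})) = x"
  using Max_in[OF finite_level[OF assms(1)] level_nonempty[OF assms(1)], of x] assms(2) by simp

section \<open>The bijection between words and monotonically ordered partitions\<close>

lemma label_level:
  assumes "w \<in> words n" "x \<in> {1..top_letter w}"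
  shows "snd (of_word w) (w -` {x}) = x"
  using assms word_Min_level by (auto simp: of_word_def levels_def)

lemma card_levels:
  assumes "w \<in> words n"
  shows "card (levels w) = top_letter w"
proof -
  have "inj_on (\<lambda>x. w -` {x}) {1..top_letter w}"
    by (rule inj_on_inverseI) (rule label_level[OF assms])
  then show ?thesis by (simp add: levels_def card_image)
qed

lemma bij_betw_labels:
  assumes "w \<in> words n"
  shows "bij_betw (snd (of_word w)) (levels w) {1..card (levels w)}"
  unfolding card_levels[OF assms]
  using label_level[OF assms]
  by (intro bij_betwI[where g = "\<lambda>x. w -` {x}"]) (auto simp: levels_def)

text \<open>Betweenness gives both properties: a crossing would force two different letters to bound
  each other, and a nested block starts between two occurrences of the outer letter, so its own
  letter is larger.\<close>

lemma of_word_in_NC_mton: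
  assumes w: "w \<in> words n"
  shows "of_word w \<in> NC_mton n"
proof -
  have "\<Union> (levels w) = {1..n}"
  proof
    show "\<Union> (levels w) \<subseteq> {1..n}"
      unfolding levels_def using level_subset[OF w] by (intro UN_least) simp
    show "{1..n} \<subseteq> \<Union> (levels w)"
    proof
      fix i assume "i \<in> {1..n}"
      then have "w i \<in> {1..top_letter w}"
        using words_pos_iff[OF w, of i] words_le_top[OF w, of i] by simp
      then show "i \<in> \<Union> (levels w)"
        unfolding levels_def by (intro UN_I) auto
    qed
  qed
  moreover have "disjoint (levels w)"
    unfolding levels_def disjoint_def by fastforce
  moreover have "{} \<notin> levels w"
    unfolding levels_def
  proof
    assume "{} \<in> (\<lambda>x. w -` {x}) ` {1..top_letter w}"
    then obtain x where "x \<le> top_letter w" "w -` {x} = {}"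
      by force
    then show False
      using level_nonempty[OF w] by blast
  qed
  ultimately have "partition_on {1..n} (levels w)"
    by (simp add: partition_on_def)
  moreover have "noncrossing (levels w)"
    unfolding noncrossing_def
  proof clarify
    fix V W a b c d
    assume VW: "V \<in> levels w" "W \<in> levels w" "V \<noteq> W"
      and lt: "a < b" "b < c" "c < (d::nat)" and "a \<in> V" "c \<in> V" "b \<in> W" "d \<in> W"
    then have "w a = w c" "w b = w d" "w a \<noteq> w b"
      by (auto simp: levels_def)
    then show False
      using words_between[OF w, of a b c] words_between[OF w, of b c d] lt by simp
  qed
  moreover have "snd (of_word w) V > snd (of_word w) W"
    if VW: "V \<in> levels w" "W \<in> levels w" and nested: "nested_inside V W" for V W
  proof -
    from VW obtain x y where x: "x \<in> {1..top_letter w}" "V = w -` {x}"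
      and y: "y \<in> {1..top_letter w}" "W = w -` {y}"
      by (auto simp: levels_def)
    \<comment> \<open>This puts \<open>Min V\<close> between the two ends of \<open>W\<close>, as
      \<open>Min W < Min V \<le> Max V < Max W\<close>.\<close>
    have "Min V \<le> Max V"
      using finite_level[OF w, of x] level_nonempty[OF w, of x] x by (intro Max_ge Min_in) auto
    then have "w (Min W) \<le> w (Min V)"
      using words_between[OF w, of "Min W" "Min V" "Max W"] nested
        word_Min_level[OF w y(1)] word_Max_level[OF w y(1)] y(2)
      by (simp add: nested_inside_def)
    then have "y \<le> x"
      using word_Min_level[OF w] x y by simp
    moreover have "x \<noteq> y"
      using nested x y by (auto simp: nested_inside_def)
    ultimately show ?thesis
      using label_level[OF w] x y by simp
  qed
  moreover have "snd (of_word w) \<in> extensional (levels w)"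
    by (simp add: of_word_def)
  ultimately have "(levels w, snd (of_word w)) \<in> NC_mton n"
    using bij_betw_labels[OF w] by (auto simp: NC_mton_def NC_def monotonic_ordering_def)
  then show ?thesis by (simp add: of_word_def)
qed

lemma inj_on_of_word: "inj_on of_word (words n)"
proof
  fix w w' assume w: "w \<in> words n" and w': "w' \<in> words n" and eq: "of_word w = of_word w'"
  show "w = w'"
  proof
    fix i
    show "w i = w' i"
    proof (cases "i \<in> {1..n}")
      case True
      then have x: "w i \<in> {1..top_letter w}"
        using words_pos_iff[OF w, of i] words_le_top[OF w, of i] by simp
      then have "w -` {w i} \<in> levels w"
        by (simp add: levels_def)
      then have "w -` {w i} \<in> levels w'"
        using eq by (simp add: of_word_def)
      then obtain y where y: "y \<in> {1..top_letter w'}" "w -` {w i} = w' -` {y}"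
        by (auto simp: levels_def)
      then have "w' i = y" by auto
      then show ?thesis
        using label_level[OF w x] label_level[OF w' y(1)] eq y(2) by simp
    next
      case False
      then show ?thesis
        using words_pos_iff[OF w, of i] words_pos_iff[OF w', of i] by (metis gr0I)
    qed
  qed
qed

text \<open>The preimage of \<open>(\<pi>, u)\<close> is the word whose letter at \<open>i\<close>
  is the label of the block containing \<open>i\<close>. Its betweenness condition combines
  noncrossing with monotonicity of \<open>u\<close>.\<close>

lemma NC_mton_subset_of_word: "NC_mton n \<subseteq> of_word ` words n"
proof clarify
  fix \<pi> u assume "(\<pi>, u) \<in> NC_mton n"
  then have part: "partition_on {1..n} \<pi>" and nc: "noncrossing \<pi>"
    and ext: "u \<in> extensional \<pi>" and bij: "bij_betw u \<pi> {1..card \<pi>}"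
    and mono: "\<And>V W. V \<in> \<pi> \<Longrightarrow> W \<in> \<pi> \<Longrightarrow> nested_inside V W \<Longrightarrow> u W < u V"
    by (auto simp: NC_mton_def NC_def monotonic_ordering_def)
  have inj: "inj_on u \<pi>" and img: "u ` \<pi> = {1..card \<pi>}"
    using bij by (auto simp: bij_betw_def)
  have sub: "V \<subseteq> {1..n}" and nonempty: "V \<noteq> {}" and fin: "finite V" if "V \<in> \<pi>" for V
    using part that finite_subset[of V "{1..n}"] by (auto simp: partition_on_def)
  have cover: "\<exists>V\<in>\<pi>. i \<in> V" if "i \<in> {1..n}" for i
    using part that by (auto simp: partition_on_def)
  define w where "w i = (if i \<in> {1..n} then u (THE V. V \<in> \<pi> \<and> i \<in> V) else 0)" for i
  have w_eq: "w i = u V" if "V \<in> \<pi>" "i \<in> V" for V i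
  proof -
    have "(THE V. V \<in> \<pi> \<and> i \<in> V) = V"
      using that partition_onD2[OF part] by (intro the_equality) (auto simp: disjoint_def)
    moreover have "i \<in> {1..n}"
      using that sub by blast
    ultimately show ?thesis by (simp add: w_def)
  qed
  have u_pos: "0 < u V" if "V \<in> \<pi>" for V
    using img that by force
  have pos: "0 < w i \<longleftrightarrow> i \<in> {1..n}" for i
  proof
    assume "i \<in> {1..n}"
    then show "0 < w i"
      using cover w_eq u_pos by metis
  qed (simp add: w_def split: if_splits)
  have level: "w -` {u V} = V" if V: "V \<in> \<pi>" for V
  proof
    show "V \<subseteq> w -` {u V}"
      using w_eq[OF V] by auto
    show "w -` {u V} \<subseteq> V"
    proof
      fix i assume i: "i \<in> w -` {u V}"
      then obtain W where "W \<in> \<pi>" "i \<in> W"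
        using cover[of i] pos[of i] u_pos[OF V] by auto
      then show "i \<in> V"
        using i w_eq[of W i] inj V by (auto dest: inj_onD)
    qed
  qed
  have range: "range w = {..card \<pi>}"
  proof -
    have "range w = insert 0 (u ` \<pi>)"
    proof
      show "range w \<subseteq> insert 0 (u ` \<pi>)"
      proof clarify
        fix i assume "w i \<notin> u ` \<pi>"
        then show "w i = 0"
          using cover[of i] w_eq pos[of i] by blast
      qed
      \<comment> \<open>Position 0 lies outside \<open>{1..n}\<close>, so the padding letter always
        occurs.\<close>
      have "0 \<in> range w"
        by (intro image_eqI[of _ _ 0]) (auto simp: w_def)
      moreover have "u V \<in> range w" if "V \<in> \<pi>" for V
        using nonempty[OF that] w_eq[OF that] by (metis all_not_in_conv rangeI)
      ultimately show "insert 0 (u ` \<pi>) \<subseteq> range w"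
        by auto
    qed
    then show ?thesis unfolding img by auto
  qed
  have "w \<in> words n"
  proof (rule wordsI[OF pos range])
    fix a b c :: nat assume le: "a \<le> b" "b \<le> c" and eq: "w a = w c"
    show "w a \<le> w b"
    proof (cases "w a = 0 \<or> w a = w b")
      case False
      then have "a \<in> {1..n}" "c \<in> {1..n}"
        using eq pos[of a] pos[of c] by auto
      then have "b \<in> {1..n}"
        using le by auto
      obtain V where V: "V \<in> \<pi>" "a \<in> V"
        using cover[OF \<open>a \<in> {1..n}\<close>] by auto
      have c: "c \<in> V"
        using level[OF V(1)] w_eq[OF V] eq by auto
      obtain W where W: "W \<in> \<pi>" "b \<in> W"
        using cover[OF \<open>b \<in> {1..n}\<close>] by auto
      have "V \<noteq> W"
        using False w_eq[OF V] w_eq[OF W] by auto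
      have lt: "a < b" "b < c"
        using le eq False by (metis order.order_iff_strict)+
      \<comment> \<open>A point of \<open>W\<close> beyond \<open>a\<close> or \<open>c\<close>
        would, together with \<open>b\<close>, cross the pair \<open>a\<close>, \<open>c\<close> of
        \<open>V\<close>. So \<open>W\<close> is trapped between \<open>a\<close> and
        \<open>c\<close> and thus nested inside \<open>V\<close>.\<close>
      have "a < d \<and> d < c" if d: "d \<in> W" for d
      proof -
        have "d \<notin> V"
          using d V(1) W(1) \<open>V \<noteq> W\<close> partition_onD2[OF part] by (auto simp: disjoint_def)
        then have "d \<noteq> a" "d \<noteq> c"
          using V c by auto
        moreover have "\<not> d < a"
          using nc V W c d lt \<open>V \<noteq> W\<close> unfolding noncrossing_def by metis
        moreover have "\<not> c < d"
          using nc V W c d lt \<open>V \<noteq> W\<close> unfolding noncrossing_def by metis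
        ultimately show ?thesis by auto
      qed
      then have "a < Min W" "Max W < c"
        using fin[OF W(1)] nonempty[OF W(1)] by auto
      moreover have "Min V \<le> a" "c \<le> Max V"
        using fin[OF V(1)] V(2) c by auto
      ultimately have "nested_inside W V"
        by (simp add: nested_inside_def)
      then show ?thesis
        using mono[OF W(1) V(1)] w_eq[OF V] w_eq[OF W] by simp
    qed auto
  qed
  moreover have "of_word w = (\<pi>, u)"
  proof -
    have levels: "levels w = \<pi>"
    proof -
      have "levels w = (\<lambda>x. w -` {x}) ` u ` \<pi>"
        by (simp add: levels_def top_letter_eq[OF range] img)
      then show ?thesis
        using level by (simp add: image_image)
    qed
    have "(\<lambda>B\<in>\<pi>. w (Min B)) = u"
    proof (rule extensionalityI[OF _ ext])
      fix V assume "V \<in> \<pi>"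
      then show "(\<lambda>B\<in>\<pi>. w (Min B)) V = u V"
        using w_eq Min_in[OF fin nonempty] by simp
    qed simp
    then show ?thesis by (simp add: of_word_def levels)
  qed
  ultimately show "(\<pi>, u) \<in> of_word ` words n"
    by force
qed

lemma bij_betw_of_word: "bij_betw of_word (words n) (NC_mton n)"
  unfolding bij_betw_def
  by (intro conjI inj_on_of_word equalityI image_subsetI of_word_in_NC_mton NC_mton_subset_of_word)

lemma finite_words: "finite (words n)"
  using bij_betw_finite[OF bij_betw_of_word] finite_NC_mton by blast

text \<open>The label of a level is its letter, and the number of blocks is the largest
  letter.\<close>

lemma J_of_word:
  assumes w: "w \<in> words n" and "1 \<le> n"
  shows "J (of_word w) = top_run w"
proof -
  have top: "top_letter w \<in> {1..top_letter w}"
    using words_top_pos[OF assms] by simp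
  then have "top_run w \<in> levels w"
    by (auto simp: top_run_def levels_def)
  then have "inv_into (levels w) (snd (of_word w)) (snd (of_word w) (top_run w)) = top_run w"
    using bij_betw_labels[OF w] by (simp add: bij_betw_def)
  then show ?thesis
    using label_level[OF w top] card_levels[OF w] by (simp add: J_def of_word_def top_run_def)
qed

section \<open>Parents and children of words\<close>

text \<open>The increasing enumeration of all positions other than \<open>m\<close>, a right inverse
  of \<open>relabel m\<close>. Precomposition with it deletes position \<open>m\<close> from a
  word.\<close>

definition skip :: "nat \<Rightarrow> nat \<Rightarrow> nat" where
  "skip m i = (if i < m then i else Suc i)"

definition word_parent :: "(nat \<Rightarrow> nat) \<Rightarrow> (nat \<Rightarrow> nat)" where
  "word_parent w = w \<circ> skip (Max (top_run w))"

text \<open>Precomposition with \<open>relabel m\<close> moves the letters from position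
  \<open>m\<close> on one place to the right; what it leaves at \<open>m\<close> itself is
  overwritten.\<close>

definition insert_top :: "(nat \<Rightarrow> nat) \<Rightarrow> nat \<Rightarrow> (nat \<Rightarrow> nat)" where
  "insert_top w m = (w \<circ> relabel m)(m := Suc (top_letter w))"

text \<open>With \<open>M = Max (top_run w)\<close>, the map \<open>relabel (Suc M)\<close> sends
  both \<open>M\<close> and \<open>Suc M\<close> to \<open>M\<close>, so the last largest letter is
  doubled.\<close>

definition extend_top :: "(nat \<Rightarrow> nat) \<Rightarrow> (nat \<Rightarrow> nat)" where
  "extend_top w = w \<circ> relabel (Suc (Max (top_run w)))"

lemma skip_neq: "skip m i \<noteq> m"
  by (simp add: skip_def)

lemma relabel_skip: "relabel m (skip m i) = i"
  by (simp add: relabel_def skip_def)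

lemma skip_relabel: "i \<noteq> m \<Longrightarrow> skip m (relabel m i) = i"
  by (auto simp: relabel_def skip_def)

lemma range_skip: "range (skip m) = - {m}"
proof -
  have "i \<in> range (skip m)" if "i \<noteq> m" for i
    using skip_relabel[OF that] by (metis rangeI)
  then show ?thesis using skip_neq by auto
qed

lemma mono_skip: "mono (skip m)"
  by (auto simp: mono_def skip_def)

lemma mono_relabel: "mono (relabel m)"
  by (auto simp: mono_def relabel_def)

text \<open>Monotone maps preserve \<open>a \<le> b \<le> c\<close>, so deleting or doubling a
  position keeps the betweenness condition.\<close>

lemma words_between_mono:
  assumes "w \<in> words n" "mono g" "a \<le> b" "b \<le> c" "w (g a) = w (g c)"
  shows "w (g a) \<le> w (g b)"
  by (rule words_between[OF assms(1) monoD[OF assms(2,3)] monoD[OF assms(2,4)] assms(5)])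

section \<open>Deleting the last occurrence of the largest letter\<close>

lemma top_run_subset: "w \<in> words n \<Longrightarrow> 1 \<le> n \<Longrightarrow> top_run w \<subseteq> {1..n}"
  unfolding top_run_def by (intro level_subset words_top_pos)

lemma finite_top_run: "w \<in> words n \<Longrightarrow> 1 \<le> n \<Longrightarrow> finite (top_run w)"
  by (rule finite_subset[OF top_run_subset]) simp_all

lemma Max_top_run_in:
  assumes "w \<in> words n" "1 \<le> n"
  shows "Max (top_run w) \<in> top_run w"
proof (rule Max_in[OF finite_top_run[OF assms]])
  show "top_run w \<noteq> {}"
    unfolding top_run_def by (rule level_nonempty[OF assms(1) order_refl])
qed

lemma card_top_run_pos: "w \<in> words n \<Longrightarrow> 1 \<le> n \<Longrightarrow> 0 < card (top_run w)"
  using finite_top_run[of w n] Max_top_run_in[of w n] by (auto simp: card_gt_0_iff)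

text \<open>Only the largest letter can disappear, and it does so exactly when it occurs once; hence
  the letters still form an initial segment.\<close>

lemma range_word_parent:
  assumes "w \<in> words n" "1 \<le> n"
  shows "range (word_parent w) =
    {..if card (top_run w) = 1 then top_letter w - 1 else top_letter w}"
proof -
  define m where "m = Max (top_run w)"
  have m: "m \<in> top_run w"
    unfolding m_def by (rule Max_top_run_in[OF assms])
  have img: "range (word_parent w) = w ` (- {m})"
    by (simp only: word_parent_def m_def[symmetric] image_comp[symmetric] range_skip)
  have range: "range w = {..top_letter w}"
    by (rule words_range[OF assms(1)])
  have wm: "w m = top_letter w"
    using m by (simp add: top_run_def)
  have split: "{..top_letter w} = insert (top_letter w) (w ` (- {m}))"
  proof -
    have "range w = w ` insert m (- {m})"
      by (rule arg_cong[of _ _ "image w"]) auto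
    then show ?thesis
      using range wm by (metis image_insert)
  qed
  show ?thesis
  proof (cases "card (top_run w) = 1")
    case True
    then have "top_run w = {m}"
      using m by (metis card_1_singletonE singletonD)
    then have "top_letter w \<notin> w ` (- {m})"
      by (auto simp: top_run_def)
    then have "w ` (- {m}) = {..top_letter w} - {top_letter w}"
      using split by blast
    \<comment> \<open>Positivity of the largest letter matters here: at 0 the truncated difference
      would give \<open>{0}\<close> instead of the empty set.\<close>
    also have "\<dots> = {..top_letter w - 1}"
      using words_top_pos[OF assms] by auto
    finally show ?thesis
      using img True by simp
  next
    case False
    then have "top_run w \<noteq> {m}" by auto
    then obtain i where i: "i \<in> top_run w" "i \<noteq> m" using m by blast
    then have "top_letter w \<in> w ` (- {m})"
      by (intro image_eqI[of _ _ i]) (simp_all add: top_run_def)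
    then have "w ` (- {m}) = {..top_letter w}"
      using split insert_absorb by metis
    then show ?thesis
      using img False by simp
  qed
qed

lemma word_parent_in_words:
  assumes w: "w \<in> words n" and n: "1 \<le> n"
  shows "word_parent w \<in> words (n - 1)"
proof (rule wordsI[OF _ range_word_parent[OF assms]])
  have "Max (top_run w) \<in> {1..n}"
    using Max_top_run_in[OF assms] top_run_subset[OF assms] by blast
  then show "0 < word_parent w i \<longleftrightarrow> i \<in> {1..n - 1}" for i
    using words_pos_iff[OF w, of "skip (Max (top_run w)) i"]
    by (auto simp: word_parent_def skip_def split: if_splits)
  show "word_parent w a \<le> word_parent w b"
    if "a \<le> b" "b \<le> c" "word_parent w a = word_parent w c" for a b c
    using that words_between_mono[OF w mono_skip] by (simp add: word_parent_def)
qed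

text \<open>This turns the images in the definition of \<open>parent\<close> into preimages, which
  fit the level sets of \<open>w \<circ> skip m\<close>.\<close>

lemma relabel_image: "relabel m ` (V - {m}) = skip m -` V"
proof
  show "relabel m ` (V - {m}) \<subseteq> skip m -` V"
    using skip_relabel by auto
  show "skip m -` V \<subseteq> relabel m ` (V - {m})"
  proof
    fix i assume "i \<in> skip m -` V"
    then show "i \<in> relabel m ` (V - {m})"
      using relabel_skip[of m i] skip_neq[of m i] by (intro image_eqI[of _ _ "skip m i"]) auto
  qed
qed

text \<open>Deleting position \<open>m\<close> turns the level of \<open>x\<close> in
  \<open>w\<close> into the level of \<open>x\<close> in the parent word, so labels are kept. The
  block \<open>{m}\<close>, if present, is the one whose letter vanishes.\<close>

lemma parent_of_word:
  assumes w: "w \<in> words n" and n: "1 \<le> n"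
  shows "parent (of_word w) = of_word (word_parent w)"
proof -
  define m where "m = Max (top_run w)"
  define w' where "w' = word_parent w"
  define \<rho> where "\<rho> = {relabel m ` (V - {m}) | V. V \<in> levels w \<and> V \<noteq> {m}}"
  have w': "w' \<in> words (n - 1)"
    unfolding w'_def by (rule word_parent_in_words[OF assms])
  have level: "relabel m ` (w -` {x} - {m}) = w' -` {x}" for x
    unfolding relabel_image by (auto simp: w'_def word_parent_def m_def)
  have top': "x \<le> top_letter w' \<longleftrightarrow> w' -` {x} \<noteq> {}" for x
    using level_nonempty[OF w', of x] words_le_top[OF w'] by auto
  have range_sub: "range w' \<subseteq> range w"
    by (auto simp: w'_def word_parent_def)
  have le: "top_letter w' \<le> top_letter w"
    using range_sub unfolding words_range[OF w] words_range[OF w'] by simp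
  have singleton: "w -` {x} \<noteq> {m} \<longleftrightarrow> w' -` {x} \<noteq> {}" if "x \<in> {1..top_letter w}" for x
    using level_nonempty[OF w, of x] that unfolding level[symmetric] by auto
  have rho: "\<rho> = levels w'"
  proof
    show "\<rho> \<subseteq> levels w'"
      unfolding \<rho>_def levels_def using singleton top' level by fastforce
    show "levels w' \<subseteq> \<rho>"
    proof
      fix B assume "B \<in> levels w'"
      then obtain x where x: "x \<in> {1..top_letter w'}" "B = w' -` {x}"
        by (auto simp: levels_def)
      then have "x \<in> {1..top_letter w}"
        using le by auto
      moreover have "w -` {x} \<noteq> {m}"
        using singleton[OF \<open>x \<in> {1..top_letter w}\<close>] top' x by auto
      ultimately show "B \<in> \<rho>"
        unfolding \<rho>_def x(2) level[symmetric] levels_def by blast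
    qed
  qed
  have "snd (of_word w) (THE V. V \<in> levels w \<and> V \<noteq> {m} \<and> B = relabel m ` (V - {m}))
      = w' (Min B)" if "B \<in> \<rho>" for B
  proof -
    obtain x where x: "x \<in> {1..top_letter w'}" "B = w' -` {x}"
      using \<open>B \<in> \<rho>\<close> unfolding rho by (auto simp: levels_def)
    then have x': "x \<in> {1..top_letter w}"
      using le by auto
    have ne: "w' -` {x} \<noteq> {}"
      using x top' by auto
    have "(THE V. V \<in> levels w \<and> V \<noteq> {m} \<and> B = relabel m ` (V - {m})) = w -` {x}"
    proof (rule the_equality)
      show "w -` {x} \<in> levels w \<and> w -` {x} \<noteq> {m} \<and> B = relabel m ` (w -` {x} - {m})"
        using x' singleton[OF x'] ne level x(2) by (auto simp: levels_def)
      fix V assume V: "V \<in> levels w \<and> V \<noteq> {m} \<and> B = relabel m ` (V - {m})"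
      then obtain y where "V = w -` {y}"
        by (auto simp: levels_def)
      then have "w' -` {x} = w' -` {y}"
        using V x(2) level by simp
      \<comment> \<open>Levels of different letters are disjoint, so a common nonempty level forces
        \<open>y = x\<close>.\<close>
      then show "V = w -` {x}"
        using ne \<open>V = w -` {y}\<close> by auto
    qed
    then show ?thesis
      using label_level[OF w x'] word_Min_level[OF w' x(1)] x(2) by simp
  qed
  moreover have "parent (of_word w) =
    (\<rho>, \<lambda>B\<in>\<rho>. snd (of_word w) (THE V. V \<in> levels w \<and> V \<noteq> {m} \<and> B = relabel m ` (V - {m})))"
    using J_of_word[OF assms]
    by (simp add: parent_def of_word_def \<rho>_def m_def Let_def)
  ultimately show ?thesis
    by (auto simp: of_word_def w'_def[symmetric] rho intro!: restrict_ext)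
qed

section \<open>Children with a new largest letter\<close>

lemma range_insert_top:
  assumes "w \<in> words n"
  shows "range (insert_top w m) = {..Suc (top_letter w)}"
proof -
  have "insert_top w m ` (- {m}) = w ` relabel m ` (- {m})"
    by (auto simp: insert_top_def)
  also have "relabel m ` (- {m}) = UNIV"
    using relabel_image[of m UNIV] by (simp add: Compl_eq_Diff_UNIV)
  finally have "insert_top w m ` (- {m}) = {..top_letter w}"
    using words_range[OF assms] by simp
  moreover have "range (insert_top w m) = insert (insert_top w m m) (insert_top w m ` (- {m}))"
    by auto
  ultimately show ?thesis by (auto simp: insert_top_def)
qed

lemma top_run_insert_top:
  assumes w: "w \<in> words n"
  shows "top_run (insert_top w m) = {m}"
proof -
  have "w i \<noteq> Suc (top_letter w)" for i
    using words_le_top[OF w, of i] by simp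
  then show ?thesis
    unfolding top_run_def top_letter_eq[OF range_insert_top[OF w]]
    by (auto simp: insert_top_def comp_def split: if_splits)
qed

lemma insert_top_in_words:
  assumes w: "w \<in> words n" and m: "m \<in> {1..Suc n}"
  shows "insert_top w m \<in> words (Suc n)"
proof (rule wordsI[OF _ range_insert_top[OF w]])
  show "0 < insert_top w m i \<longleftrightarrow> i \<in> {1..Suc n}" for i
  proof (cases i m rule: linorder_cases)
    case greater
    then show ?thesis
      using words_pos_iff[OF w, of "i - 1"] m by (auto simp: insert_top_def relabel_def)
  qed (use words_pos_iff[OF w, of i] m in \<open>auto simp: insert_top_def relabel_def\<close>)
  have less: "w i < Suc (top_letter w)" for i
    using words_le_top[OF w] by (simp add: less_Suc_eq_le)
  show "insert_top w m a \<le> insert_top w m b"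
    if le: "a \<le> b" "b \<le> c" and eq: "insert_top w m a = insert_top w m c" for a b c
  proof (cases "a = m \<or> b = m")
    case True
    \<comment> \<open>The new letter occurs only at \<open>m\<close>. So \<open>a = m\<close> forces
      \<open>c = m\<close> and \<open>b = m\<close>, and in either case \<open>b\<close> carries the
      largest letter of all.\<close>
    have "c = m" if "a = m"
      using eq that less[of "relabel m c"] by (simp add: insert_top_def split: if_splits)
    then have "b = m"
      using True le by auto
    then show ?thesis
      using less[of "relabel m a"] by (simp add: insert_top_def)
  next
    case False
    then have "c \<noteq> m"
      using eq less[of "relabel m a"] by (auto simp: insert_top_def)
    then show ?thesis
      using False eq words_between_mono[OF w mono_relabel le] by (simp add: insert_top_def)
  qed
qed

lemma word_parent_insert_top: "w \<in> words n \<Longrightarrow> word_parent (insert_top w m) = w"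
  unfolding word_parent_def top_run_insert_top
  by (rule ext) (simp add: insert_top_def skip_neq relabel_skip)

lemma insert_top_word_parent:
  assumes w: "w \<in> words n" "1 \<le> n" and run: "card (top_run w) = 1"
  shows "insert_top (word_parent w) (Max (top_run w)) = w"
proof -
  have "Suc (top_letter (word_parent w)) = top_letter w"
    using top_letter_eq[OF range_word_parent[OF w]] run words_top_pos[OF w] by simp
  moreover have "w (Max (top_run w)) = top_letter w"
    using Max_top_run_in[OF w] by (simp add: top_run_def)
  ultimately show ?thesis
    by (auto simp: insert_top_def word_parent_def skip_relabel)
qed

text \<open>The new letter exceeds all others, so betweenness allows it at each of the
  \<open>Suc n\<close> positions. The inverse records the parent and the position of the deleted
  letter.\<close>

lemma bij_betw_insert_top:
  "bij_betw (\<lambda>(w, m). insert_top w m) (words n \<times> {1..Suc n})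
     {w \<in> words (Suc n). card (top_run w) = 1}"
proof (rule bij_betwI[where g = "\<lambda>w. (word_parent w, Max (top_run w))"])
  show "(\<lambda>(w, m). insert_top w m) \<in>
      words n \<times> {1..Suc n} \<rightarrow> {w \<in> words (Suc n). card (top_run w) = 1}"
    using insert_top_in_words top_run_insert_top by auto
  show "(\<lambda>w. (word_parent w, Max (top_run w))) \<in>
      {w \<in> words (Suc n). card (top_run w) = 1} \<rightarrow> words n \<times> {1..Suc n}"
    using word_parent_in_words[of _ "Suc n"] Max_top_run_in[of _ "Suc n"]
      top_run_subset[of _ "Suc n"] by fastforce
qed (auto simp: word_parent_insert_top top_run_insert_top insert_top_word_parent)

section \<open>Children with a longer run of the largest letter\<close>

lemma top_run_extend_top:
  assumes w: "w \<in> words n" "1 \<le> n"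
  shows "range (extend_top w) = range w"
    and "top_run (extend_top w) = insert (Suc (Max (top_run w))) (top_run w)"
proof -
  define m where "m = Max (top_run w)"
  have "w ` range (relabel (Suc m)) = range w"
  proof -
    have "range (relabel (Suc m)) = UNIV"
      using relabel_skip by (metis surjI)
    then show ?thesis by simp
  qed
  then show range: "range (extend_top w) = range w"
    by (simp add: extend_top_def m_def image_comp)
  have m: "w m = top_letter w"
    using Max_top_run_in[OF w] by (simp add: m_def top_run_def)
  have max: "i \<le> m" if "w i = top_letter w" for i
    using that finite_top_run[OF w] by (simp add: m_def top_run_def)
  \<comment> \<open>Positions up to \<open>m\<close> are unchanged, and those beyond
    \<open>Suc m\<close> receive letters from beyond \<open>m\<close>, none of which is the
    largest.\<close>
  have "w (relabel (Suc m) i) = top_letter w \<longleftrightarrow> i = Suc m \<or> w i = top_letter w" for i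
    using m max[of i] max[of "i - 1"] by (auto simp: relabel_def)
  moreover have "top_letter (w \<circ> relabel (Suc m)) = top_letter w"
    using range by (simp only: top_letter_def extend_top_def m_def)
  ultimately show "top_run (extend_top w) = insert (Suc (Max (top_run w))) (top_run w)"
    unfolding extend_top_def m_def[symmetric] by (intro set_eqI) (simp add: top_run_def)
qed

lemma Max_top_run_extend_top:
  assumes "w \<in> words n" "1 \<le> n"
  shows "Max (top_run (extend_top w)) = Suc (Max (top_run w))"
proof -
  have "Max (insert (Suc (Max (top_run w))) (top_run w)) = Suc (Max (top_run w))"
    using finite_top_run[OF assms] by (intro Max_eqI) (auto simp: le_SucI)
  then show ?thesis by (simp add: top_run_extend_top[OF assms])
qed

lemma card_top_run_extend_top:
  assumes "w \<in> words n" "1 \<le> n"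
  shows "card (top_run (extend_top w)) = Suc (card (top_run w))"
proof -
  have "Suc (Max (top_run w)) \<notin> top_run w"
    using finite_top_run[OF assms] Max_ge not_less_eq_eq by blast
  then show ?thesis
    using finite_top_run[OF assms] by (simp add: top_run_extend_top[OF assms])
qed

lemma extend_top_in_words:
  assumes w: "w \<in> words n" "1 \<le> n"
  shows "extend_top w \<in> words (Suc n)"
proof (rule wordsI)
  show "range (extend_top w) = {..top_letter w}"
    using top_run_extend_top(1)[OF w] words_range[OF w(1)] by simp
  have "Max (top_run w) \<in> {1..n}"
    using Max_top_run_in[OF w] top_run_subset[OF w] by blast
  then show "0 < extend_top w i \<longleftrightarrow> i \<in> {1..Suc n}" for i
    using words_pos_iff[OF w(1), of "relabel (Suc (Max (top_run w))) i"]
    by (auto simp: extend_top_def relabel_def split: if_splits)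
  show "extend_top w a \<le> extend_top w b"
    if "a \<le> b" "b \<le> c" "extend_top w a = extend_top w c" for a b c
    using that words_between_mono[OF w(1) mono_relabel] by (simp add: extend_top_def)
qed

lemma word_parent_extend_top:
  "w \<in> words n \<Longrightarrow> 1 \<le> n \<Longrightarrow> word_parent (extend_top w) = w"
  unfolding word_parent_def Max_top_run_extend_top
  by (rule ext) (simp add: extend_top_def relabel_skip)

text \<open>The run is an interval with at least two elements, so \<open>m - 1\<close> also carries
  the largest letter; deleting it at \<open>m\<close> and doubling it at \<open>m - 1\<close>
  cancel.\<close>

lemma extend_top_word_parent:
  assumes w: "w \<in> words n" "1 \<le> n" and run: "card (top_run w) \<noteq> 1"
  shows "extend_top (word_parent w) = w"
proof -
  define m where "m = Max (top_run w)"
  have m: "m \<in> top_run w"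
    unfolding m_def by (rule Max_top_run_in[OF w])
  have max: "i \<le> m" if "i \<in> top_run w" for i
    using that finite_top_run[OF w] by (simp add: m_def)
  obtain i where i: "i \<in> top_run w" "i \<noteq> m"
  proof -
    have "top_run w \<noteq> {m}"
      using run by auto
    then show ?thesis
      using m that by blast
  qed
  then have im: "i \<le> m - 1" "0 < m"
    using max[of i] by auto
  have "w i \<le> w (m - 1)"
    using im i m by (intro words_between[OF w(1), of _ _ m]) (auto simp: top_run_def)
  then have pred: "w (m - 1) = top_letter w"
    using i words_le_top[OF w(1), of "m - 1"] by (simp add: top_run_def)
  have top: "top_letter (word_parent w) = top_letter w"
    using top_letter_eq[OF range_word_parent[OF w]] run by simp
  have "Max (top_run (word_parent w)) = m - 1"
  proof (rule Max_eqI)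
    have run': "top_run (word_parent w) = skip m -` top_run w"
      by (auto simp: top_run_def top) (auto simp: word_parent_def m_def top_run_def)
    show "m - 1 \<in> top_run (word_parent w)"
      using im(2) pred unfolding run' by (simp add: skip_def top_run_def)
    show "j \<le> m - 1" if "j \<in> top_run (word_parent w)" for j
      using that max[of "skip m j"] unfolding run' by (auto simp: skip_def split: if_splits)
    then show "finite (top_run (word_parent w))"
      by (meson finite_nat_set_iff_bounded_le)
  qed
  then have "extend_top (word_parent w) j = w (skip m (relabel m j))" for j
    using im(2) by (simp add: extend_top_def word_parent_def m_def[symmetric])
  \<comment> \<open>Only \<open>j = m\<close> is moved, namely to \<open>m - 1\<close>, where
    \<open>w\<close> has the same letter.\<close>
  moreover have "w (skip m (relabel m j)) = w j" for j
  proof (cases "j = m")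
    case True
    then show ?thesis
      using im(2) pred m by (simp add: skip_def relabel_def top_run_def)
  qed (simp add: skip_relabel)
  ultimately show ?thesis by auto
qed

text \<open>Each word has exactly one child of this kind. For \<open>n = 0\<close> this fails:
  \<open>words 0\<close> contains the zero word, while the target is empty.\<close>

lemma bij_betw_extend_top:
  assumes "1 \<le> n"
  shows "bij_betw extend_top (words n) {w \<in> words (Suc n). card (top_run w) \<noteq> 1}"
proof (rule bij_betwI[where g = word_parent])
  show "extend_top \<in> words n \<rightarrow> {w \<in> words (Suc n). card (top_run w) \<noteq> 1}"
    using extend_top_in_words card_top_run_extend_top card_top_run_pos assms by auto
  show "word_parent \<in> {w \<in> words (Suc n). card (top_run w) \<noteq> 1} \<rightarrow> words n"
    using word_parent_in_words[of _ "Suc n"] by auto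
qed (use assms in \<open>auto simp: word_parent_extend_top extend_top_word_parent\<close>)

section \<open>The recursion\<close>

definition weight :: "(nat \<Rightarrow> ordered_partition \<Rightarrow> real) \<Rightarrow> real \<Rightarrow> nat \<Rightarrow> (nat \<Rightarrow> nat) \<Rightarrow> real" where
  "weight Z t n w = t powr Z n (of_word w)"

text \<open>This is the \<open>A n j\<close> of the outline.\<close>

definition L_run :: "(nat \<Rightarrow> ordered_partition \<Rightarrow> real) \<Rightarrow> real \<Rightarrow> nat \<Rightarrow> nat \<Rightarrow> real" where
  "L_run Z t n j = (\<Sum>w | w \<in> words n \<and> card (top_run w) = j. weight Z t n w)"

lemma L_eq_sum_weight: "L Z n t = (\<Sum>w\<in>words n. weight Z t n w)"
  unfolding L_def weight_def by (rule sum.reindex_bij_betw[OF bij_betw_of_word, symmetric])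

text \<open>The additive recursion for \<open>Z\<close>, carried over to words, becomes
  multiplicative under \<open>powr\<close>.\<close>

lemma weight_eq:
  assumes "recursive_first_kind k r Z" "w \<in> words (Suc n)" "1 \<le> n"
  shows "weight Z t (Suc n) w = weight Z t n (word_parent w) *
    (if card (top_run w) \<le> k then t powr r (card (top_run w)) else 1)"
proof -
  have "Z (Suc n) (of_word w) = Z n (of_word (word_parent w)) +
      (if card (top_run w) \<le> k then r (card (top_run w)) else 0)"
    using assms(1)[unfolded recursive_first_kind_def, rule_format, of "Suc n" "of_word w"]
      of_word_in_NC_mton[OF assms(2)] J_of_word[OF assms(2)] parent_of_word[OF assms(2)] assms(3)
    by simp
  then show ?thesis by (simp add: weight_def powr_add)
qed

text \<open>All \<open>Suc n\<close> insertions into a given word have the same weight, whatever the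
  position.\<close>

lemma L_run_one:
  assumes "recursive_first_kind k r Z" "1 \<le> n" "1 \<le> k"
  shows "L_run Z t (Suc n) 1 = real (Suc n) * t powr r 1 * L Z n t"
proof -
  have "L_run Z t (Suc n) 1 =
      (\<Sum>(w, m)\<in>words n \<times> {1..Suc n}. weight Z t (Suc n) (insert_top w m))"
    unfolding L_run_def sum.reindex_bij_betw[OF bij_betw_insert_top[of n], symmetric]
    by (simp add: case_prod_unfold)
  also have "\<dots> = (\<Sum>(w, m)\<in>words n \<times> {1..Suc n}. weight Z t n w * t powr r 1)"
    using assms insert_top_in_words
    by (intro sum.cong) (auto simp: weight_eq top_run_insert_top word_parent_insert_top)
  also have "\<dots> = real (Suc n) * t powr r 1 * L Z n t"
    by (simp add: sum.cartesian_product[symmetric] L_eq_sum_weight sum_distrib_left mult_ac)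
  finally show ?thesis .
qed

lemma weight_extend_top:
  assumes "recursive_first_kind k r Z" "1 \<le> n" "w \<in> words n"
  shows "weight Z t (Suc n) (extend_top w) = weight Z t n w *
    (if Suc (card (top_run w)) \<le> k then t powr r (Suc (card (top_run w))) else 1)"
  using weight_eq[OF assms(1) extend_top_in_words[OF assms(3,2)] assms(2)] assms
  by (simp add: card_top_run_extend_top word_parent_extend_top)

lemma L_run_Suc:
  assumes "recursive_first_kind k r Z" "1 \<le> n" "1 \<le> j" "Suc j \<le> k"
  shows "L_run Z t (Suc n) (Suc j) = t powr r (Suc j) * L_run Z t n j"
proof -
  have "bij_betw extend_top {w \<in> words n. card (top_run w) = j}
      {w \<in> words (Suc n). card (top_run w) = Suc j}"
    (is "bij_betw _ ?A ?B")
  proof (rule bij_betw_subset[OF bij_betw_extend_top[OF assms(2)]])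
    show "extend_top ` ?A = ?B"
    proof
      show "extend_top ` ?A \<subseteq> ?B"
        using assms(2) by (auto simp: extend_top_in_words card_top_run_extend_top)
      show "?B \<subseteq> extend_top ` ?A"
      proof clarify
        fix w assume w: "w \<in> words (Suc n)" "card (top_run w) = Suc j"
        \<comment> \<open>Since \<open>1 \<le> j\<close>, the run length \<open>Suc j\<close>
          differs from 1, so \<open>w\<close> arises by extension.\<close>
        then have "w \<in> extend_top ` words n"
          using bij_betw_imp_surj_on[OF bij_betw_extend_top[OF assms(2)]] assms(3) by simp
        then obtain w' where "w' \<in> words n" "w = extend_top w'"
          by blast
        then show "w \<in> extend_top ` ?A"
          using w(2) assms(2) by (auto simp: card_top_run_extend_top)
      qed
    qed
  qed auto
  then have "L_run Z t (Suc n) (Suc j) = (\<Sum>w\<in>?A. weight Z t (Suc n) (extend_top w))"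
    unfolding L_run_def by (simp add: sum.reindex_bij_betw)
  also have "\<dots> = (\<Sum>w\<in>?A. t powr r (Suc j) * weight Z t n w)"
    using assms by (intro sum.cong) (auto simp: weight_extend_top)
  finally show ?thesis by (simp add: L_run_def sum_distrib_left)
qed

text \<open>Shortening the run step by step collects the exponents \<open>r j\<close>, ...,
  \<open>r 2\<close>; the final run of length 1 contributes \<open>r 1\<close> and the number
  \<open>Suc n\<close> of insertions.\<close>

lemma L_run_eq:
  assumes "recursive_first_kind k r Z" "1 \<le> n" "1 \<le> j" "j \<le> k"
  shows "L_run Z t (n + j) j = real (Suc n) * t powr (\<Sum>i=1..j. r i) * L Z n t"
  using assms(3,4)
proof (induction j rule: dec_induct)
  case base
  then show ?case using L_run_one[OF assms(1,2)] by simp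
next
  case (step j)
  then show ?case
    using L_run_Suc[OF assms(1), of "n + j" j] by (simp add: powr_add mult_ac)
qed

lemma L_Suc:
  assumes rec: "recursive_first_kind k r Z" and n: "1 \<le> n" and k: "1 \<le> k"
  shows "L Z (Suc n) t = (1 + real (Suc n) * t powr r 1) * L Z n t +
    (\<Sum>j=2..k. (t powr r j - 1) * L_run Z t n (j - 1))"
proof -
  let ?c = "\<lambda>j. if j \<le> k then t powr r j else 1"
  have "L Z (Suc n) t = L_run Z t (Suc n) 1 +
      (\<Sum>w | w \<in> words (Suc n) \<and> card (top_run w) \<noteq> 1. weight Z t (Suc n) w)"
    unfolding L_eq_sum_weight L_run_def
    by (subst sum.union_disjoint[symmetric])
      (auto intro!: sum.cong intro: finite_subset[OF _ finite_words])
  also have "(\<Sum>w | w \<in> words (Suc n) \<and> card (top_run w) \<noteq> 1. weight Z t (Suc n) w) =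
      (\<Sum>w\<in>words n. weight Z t n w * ?c (Suc (card (top_run w))))"
    unfolding sum.reindex_bij_betw[OF bij_betw_extend_top[OF n], symmetric]
    by (simp add: weight_extend_top[OF rec n])
  \<comment> \<open>Writing the factor as 1 plus a remainder splits off \<open>L Z n t\<close>; the
    remainder vanishes once the extended run is longer than \<open>k\<close>.\<close>
  also have "\<dots> = L Z n t + (\<Sum>w\<in>words n. weight Z t n w * (?c (Suc (card (top_run w))) - 1))"
    by (simp add: L_eq_sum_weight sum.distrib[symmetric] algebra_simps)
  also have "(\<Sum>w\<in>words n. weight Z t n w * (?c (Suc (card (top_run w))) - 1)) =
      (\<Sum>w\<in>words n. \<Sum>j=2..k.
        if card (top_run w) = j - 1 then (t powr r j - 1) * weight Z t n w else 0)"
  proof (rule sum.cong[OF refl])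
    fix w assume "w \<in> words n"
    then have "card (top_run w) = j - 1 \<longleftrightarrow> Suc (card (top_run w)) = j" if "2 \<le> j" for j
      using that by auto
    then have "(\<Sum>j=2..k.
        if card (top_run w) = j - 1 then (t powr r j - 1) * weight Z t n w else 0) =
      (\<Sum>j=2..k.
        if Suc (card (top_run w)) = j then (t powr r j - 1) * weight Z t n w else 0)"
      by (intro sum.cong) auto
    then show "weight Z t n w * (?c (Suc (card (top_run w))) - 1) = (\<Sum>j=2..k.
        if card (top_run w) = j - 1 then (t powr r j - 1) * weight Z t n w else 0)"
      \<comment> \<open>Runs are nonempty, so \<open>Suc (card (top_run w))\<close> is at least 2;
        it is an index of the sum exactly when it is at most \<open>k\<close>.\<close>
      using card_top_run_pos[OF \<open>w \<in> words n\<close> n] by (simp add: mult_ac)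
  qed
  also have "\<dots> = (\<Sum>j=2..k. (t powr r j - 1) * L_run Z t n (j - 1))"
    by (subst sum.swap)
      (simp add: L_run_def sum_distrib_left sum.If_cases[OF finite_words] Int_def)
  finally show ?thesis
    using L_run_one[OF rec n k] by (simp add: algebra_simps)
qed

theorem theorem3p2:
  fixes k n :: nat and r :: "nat \<Rightarrow> real"
    and Z :: "nat \<Rightarrow> ordered_partition \<Rightarrow> real" and t :: real
  assumes "k \<ge> 2"
    and "recursive_first_kind k r Z"
    and "n > k"
    and "t > 0"
  shows "L Z n t =
    (1 + real n * t powr r 1) * L Z (n - 1) t +
    (\<Sum>j=2..k. (real n - real j + 1) * (t powr r j - 1) *
       t powr (\<Sum>i=1..j - 1. r i) * L Z (n - j) t)"
proof -
  \<comment> \<open>Here \<open>n - 1 = (n - j) + (j - 1)\<close>, and \<open>n > k \<ge> j\<close>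
    gives \<open>1 \<le> n - j\<close>; the factor \<open>Suc (n - j)\<close> is the coefficient
    \<open>n - j + 1\<close>.\<close>
  have "L_run Z t (n - 1) (j - 1) =
      (real n - real j + 1) * t powr (\<Sum>i=1..j - 1. r i) * L Z (n - j) t"
    if "j \<in> {2..k}" for j
    using L_run_eq[OF assms(2), of "n - j" "j - 1" t] that assms(3)
    by (auto simp: of_nat_diff add.commute)
  then show ?thesis
    using L_Suc[OF assms(2), of "n - 1" t] assms(1,3) by (simp add: mult_ac)
qed

end
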